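(* If the graph $G$ is connected, non-bipartite and total $k$-uniform, then $G\times K_2$ is a connected total $2k$-uniform graph.
   Context: All graphs are finite and simple. The direct product $G\times H$ has vertex set $V(G)\times V(H)$, with $(g,h)$ adjacent to $(g',h')$ iff $gg'\in E(G)$ and $hh'\in E(H)$. $N(v)$ is the set of neighbors of $v$. For a graph $G$ with no isolated vertices, a total dominating set is a set $A\subseteq V(G)$ such that every vertex of $G$ has a neighbor in $A$; $\gamma_t(G)$ is the minimum size of one. A sequence $(v_1,\dots,v_m)$ of distinct vertices is legal if $N(v_i)\setminus\bigcup_{j=1}^{i-1}N(v_j)\neq\emptyset$ for every $i\in\{2,\dots,m\}$; it is a total dominating sequence if moreover $\{v_1,\dots,v_m\}$ is a total dominating set. $\gamma_{gr}^t(G)$ is the maximum length of a total dominating sequence. $G$ is total $k$-uniform if $\gamma_t(G)=\gamma_{gr}^t(G)=k$. *)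

theory Defs
  imports "Graph_Theory.Graph_Theory"
begin

text \<open>Finite simple graphs are represented as \<^locale>\<open>pair_graph\<close>: an undirected edge \<open>uv\<close>
  is the pair of arcs \<open>(u, v)\<close>, \<open>(v, u)\<close>.\<close>

definition neighbors :: "'a pair_pre_digraph \<Rightarrow> 'a \<Rightarrow> 'a set" where
  "neighbors G v = {u. (v, u) \<in> parcs G}"

definition no_isolated_vertices :: "'a pair_pre_digraph \<Rightarrow> bool" where
  "no_isolated_vertices G \<longleftrightarrow> (\<forall>v \<in> pverts G. neighbors G v \<noteq> {})"

definition bipartite :: "'a pair_pre_digraph \<Rightarrow> bool" where
  "bipartite G \<longleftrightarrow>
    (\<exists>U V. pverts G = U \<union> V \<and> U \<inter> V = {} \<and> parcs G \<subseteq> U \<times> V \<union> V \<times> U)"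

definition direct_product ::
  "'a pair_pre_digraph \<Rightarrow> 'b pair_pre_digraph \<Rightarrow> ('a \<times> 'b) pair_pre_digraph" where
  "direct_product G H =
    \<lparr> pverts = pverts G \<times> pverts H,
      parcs = {((g, h), (g', h')) | g h g' h'. (g, g') \<in> parcs G \<and> (h, h') \<in> parcs H} \<rparr>"

definition total_dominating_set :: "'a pair_pre_digraph \<Rightarrow> 'a set \<Rightarrow> bool" where
  "total_dominating_set G A \<longleftrightarrow>
    A \<subseteq> pverts G \<and> (\<forall>v \<in> pverts G. neighbors G v \<inter> A \<noteq> {})"

definition total_domination_number :: "'a pair_pre_digraph \<Rightarrow> nat" where
  "total_domination_number G = Min {card A | A. total_dominating_set G A}"

text \<open>List positions start at 0, so the first vertex of a sequence, which is exempt from the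
  condition on new neighbors, is \<open>vs ! 0\<close>.\<close>

definition legal_sequence :: "'a pair_pre_digraph \<Rightarrow> 'a list \<Rightarrow> bool" where
  "legal_sequence G vs \<longleftrightarrow>
    set vs \<subseteq> pverts G \<and> distinct vs \<and>
    (\<forall>i \<in> {1..<length vs}. neighbors G (vs ! i) - (\<Union>j<i. neighbors G (vs ! j)) \<noteq> {})"

definition total_dominating_sequence :: "'a pair_pre_digraph \<Rightarrow> 'a list \<Rightarrow> bool" where
  "total_dominating_sequence G vs \<longleftrightarrow>
    legal_sequence G vs \<and> total_dominating_set G (set vs)"

definition grundy_total_domination_number :: "'a pair_pre_digraph \<Rightarrow> nat" where
  "grundy_total_domination_number G = Max {length vs | vs. total_dominating_sequence G vs}"

text \<open>Both numbers are meaningful only in the absence of isolated vertices (otherwise \<^const>\<open>Min\<close>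
  and \<^const>\<open>Max\<close> are applied to the empty set), so uniformity includes that requirement.\<close>

definition total_uniform :: "nat \<Rightarrow> 'a pair_pre_digraph \<Rightarrow> bool" where
  "total_uniform k G \<longleftrightarrow>
    no_isolated_vertices G \<and>
    total_domination_number G = k \<and> grundy_total_domination_number G = k"

end

theory Submission
  imports Defs
begin

text \<open>Let \<open>a\<close>, \<open>b\<close> be the vertices of \<open>K\<^sub>2\<close>. A vertex of the layer \<open>a\<close> is only dominated from the
  layer \<open>b\<close> and vice versa, and both layers carry a copy of the neighborhoods of \<open>G\<close>. Hence both
  layers of a total dominating set of \<open>G \<times> K\<^sub>2\<close> are total dominating sets of \<open>G\<close>, and both layers
  of a total dominating sequence, in the inherited order, are total dominating sequences of \<open>G\<close>.
  This bounds \<open>\<gamma>\<^sub>t(G \<times> K\<^sub>2)\<close> from below and \<open>\<gamma>\<^sub>g\<^sub>r\<^sup>t(G \<times> K\<^sub>2)\<close> from above by \<open>2k\<close>, and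
  \<open>\<gamma>\<^sub>t \<le> \<gamma>\<^sub>g\<^sub>r\<^sup>t\<close> always. If \<open>G \<times> K\<^sub>2\<close> were disconnected, the two layers of a component would
  be a bipartition of \<open>G\<close>.\<close>

section \<open>Connectedness and direct products of undirected graphs\<close>

text \<open>The library takes connectedness in the symmetric closure; the arcs here are already
  symmetric, so reachability in the graph itself decides it.\<close>

lemma pair_graph_connected_iff:
  assumes "pair_graph G"
  shows "Digraph_Component.connected (with_proj G) \<longleftrightarrow>
    pverts G \<noteq> {} \<and> (\<forall>u \<in> pverts G. \<forall>v \<in> pverts G. u \<rightarrow>\<^sup>*\<^bsub>with_proj G\<^esub> v)"
proof -
  interpret pair_graph G by fact
  show ?thesis
    unfolding connected_def strongly_connected_def
    by (simp add: reachable_mk_symmetric_eq[OF pair_sym_arcs])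
qed

lemma pair_graph_direct_product:
  assumes "pair_graph G" "pair_graph H"
  shows "pair_graph (direct_product G H)"
proof -
  interpret G: pair_graph G by fact
  interpret H: pair_graph H by fact
  have sub: "parcs (direct_product G H) \<subseteq> (pverts G \<times> pverts H) \<times> (pverts G \<times> pverts H)"
    by (auto simp: direct_product_def dest: G.in_arcsD1 G.in_arcsD2 H.in_arcsD1 H.in_arcsD2)
  show ?thesis
  proof
    show "finite (parcs (direct_product G H))"
      by (rule finite_subset[OF sub]) (simp add: G.pair_finite_verts H.pair_finite_verts)
    show "symmetric (with_proj (direct_product G H))"
      by (auto simp: symmetric_def direct_product_def
          intro!: symI dest: G.arcs_symmetric H.arcs_symmetric)
  qed (auto simp: direct_product_def G.pair_finite_verts H.pair_finite_verts
      dest: G.pair_no_loops G.in_arcsD1 G.in_arcsD2 H.in_arcsD1 H.in_arcsD2)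
qed

lemma neighbors_direct_product:
  "neighbors (direct_product G H) (g, h) = neighbors G g \<times> neighbors H h"
  by (auto simp: neighbors_def direct_product_def)

lemma pverts_direct_product: "pverts (direct_product G H) = pverts G \<times> pverts H"
  by (simp add: direct_product_def)

section \<open>Legal sequences and total dominating sets\<close>

text \<open>Splits of the list replace positions because they survive passing to a sublist. The
  exempt first vertex is the case \<open>xs = []\<close>, where the condition just says that
  \<open>neighbors G y\<close> is nonempty.\<close>

lemma legal_sequence_append_iff:
  assumes "no_isolated_vertices G"
  shows "legal_sequence G vs \<longleftrightarrow> set vs \<subseteq> pverts G \<and> distinct vs \<and>
    (\<forall>xs y ys. vs = xs @ y # ys \<longrightarrow> \<not> neighbors G y \<subseteq> (\<Union>x \<in> set xs. neighbors G x))"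
    (is "?L \<longleftrightarrow> ?V \<and> ?D \<and> ?R")
proof safe
  fix xs y ys
  assume L: "legal_sequence G (xs @ y # ys)"
    and sub: "neighbors G y \<subseteq> (\<Union>x \<in> set xs. neighbors G x)"
  show False
  proof (cases xs)
    case Nil
    then show ?thesis
      using L sub assms by (auto simp: legal_sequence_def no_isolated_vertices_def)
  next
    case (Cons z zs)
    then have "length xs \<in> {1..<length (xs @ y # ys)}" by simp
    with L have "neighbors G ((xs @ y # ys) ! length xs)
        - (\<Union>j<length xs. neighbors G ((xs @ y # ys) ! j)) \<noteq> {}"
      unfolding legal_sequence_def by blast
    moreover have "(\<Union>j<length xs. neighbors G ((xs @ y # ys) ! j))
        = (\<Union>x \<in> set xs. neighbors G x)"
      by (force simp: nth_append in_set_conv_nth)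
    ultimately show ?thesis using sub by simp
  qed
next
  assume *: ?V ?D ?R
  have "neighbors G (vs ! i) - (\<Union>j<i. neighbors G (vs ! j)) \<noteq> {}" if "i < length vs" for i
  proof -
    have "\<not> neighbors G (vs ! i) \<subseteq> (\<Union>x \<in> set (take i vs). neighbors G x)"
      using *(3) id_take_nth_drop[OF that] by blast
    moreover have "set (take i vs) = (!) vs ` {..<i}"
      using that nth_image[of i vs] by (simp add: lessThan_atLeast0)
    ultimately show ?thesis by auto
  qed
  with * show ?L by (auto simp: legal_sequence_def)
qed (auto simp: legal_sequence_def)

lemma total_dominating_set_pverts:
  assumes "pair_graph G" "no_isolated_vertices G"
  shows "total_dominating_set G (pverts G)"
proof -
  interpret pair_graph G by fact
  show ?thesis
    using assms(2)
    by (fastforce simp: total_dominating_set_def no_isolated_vertices_def neighbors_def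
        dest: in_arcsD2)
qed

lemma finite_total_dominating_set_cards:
  assumes "finite (pverts G)"
  shows "finite {card A | A. total_dominating_set G A}"
  by (rule finite_subset[of _ "card ` Pow (pverts G)"])
    (use assms in \<open>auto simp: total_dominating_set_def\<close>)

lemma finite_total_dominating_sequence_lengths:
  assumes "finite (pverts G)"
  shows "finite {length vs | vs. total_dominating_sequence G vs}"
  by (rule finite_subset[of _ "{..card (pverts G)}"])
    (use assms in \<open>auto simp: total_dominating_sequence_def legal_sequence_def
      simp flip: distinct_card intro: card_mono\<close>)

text \<open>In a minimum total dominating set every vertex has a private neighbor, so that any
  enumeration of the set is legal.\<close>

lemma total_dominating_sequence_of_minimum:
  assumes "pair_graph G" "no_isolated_vertices G"
    and A: "total_dominating_set G A"
    and min: "\<And>B. total_dominating_set G B \<Longrightarrow> card A \<le> card B"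
  obtains vs where "total_dominating_sequence G vs" "set vs = A" "length vs = card A"
proof -
  interpret pair_graph G by fact
  have finA: "finite A"
    using A pair_finite_verts by (auto simp: total_dominating_set_def intro: finite_subset)
  then obtain vs where vs: "set vs = A" "distinct vs"
    using finite_distinct_list by blast
  have "\<not> neighbors G y \<subseteq> (\<Union>x \<in> set xs. neighbors G x)" if eq: "vs = xs @ y # ys" for xs y ys
  proof -
    have y: "y \<in> A" "set xs \<subseteq> A - {y}" using vs eq by auto
    \<comment> \<open>By minimality, deleting \<open>y\<close> leaves some \<open>w\<close>
      undominated. As \<open>A\<close> dominates \<open>w\<close>, only \<open>y\<close> can do so,
      and \<open>w\<close> is new whatever precedes \<open>y\<close>.\<close>
    have "\<not> total_dominating_set G (A - {y})"
      using min[of "A - {y}"] card_Diff1_less[OF finA y(1)] by auto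
    then obtain w where w: "w \<in> pverts G" "neighbors G w \<inter> (A - {y}) = {}"
      using A by (auto simp: total_dominating_set_def)
    moreover have "neighbors G w \<inter> A \<noteq> {}"
      using A w(1) by (auto simp: total_dominating_set_def)
    ultimately have "w \<in> neighbors G y" "\<forall>x \<in> A - {y}. w \<notin> neighbors G x"
      by (auto simp: neighbors_def dest: arcs_symmetric)
    then show ?thesis using y(2) by blast
  qed
  then have "legal_sequence G vs"
    using vs A by (auto simp: legal_sequence_append_iff[OF assms(2)] total_dominating_set_def)
  then show thesis
    using that[of vs] vs A distinct_card[OF vs(2)] by (simp add: total_dominating_sequence_def)
qed

text \<open>Replaces \<open>Min\<close> and \<open>Max\<close> by attained bounds. A sequence of
  length \<open>k\<close> comes from enumerating a set that attains the minimum.\<close>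

lemma total_uniform_iff:
  assumes "pair_graph G"
  shows "total_uniform k G \<longleftrightarrow> no_isolated_vertices G \<and>
    (\<exists>A. total_dominating_set G A \<and> card A = k) \<and>
    (\<forall>A. total_dominating_set G A \<longrightarrow> k \<le> card A) \<and>
    (\<forall>vs. total_dominating_sequence G vs \<longrightarrow> length vs \<le> k)"
    (is "?L \<longleftrightarrow> ?I \<and> ?E \<and> ?A \<and> ?S")
proof -
  interpret pair_graph G by fact
  let ?C = "{card A | A. total_dominating_set G A}"
  let ?M = "{length vs | vs. total_dominating_sequence G vs}"
  note fin = finite_total_dominating_set_cards[OF pair_finite_verts]
    finite_total_dominating_sequence_lengths[OF pair_finite_verts]
  show ?thesis
  proof
    assume L: ?L
    then have I: ?I and k: "Min ?C = k" "Max ?M = k"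
      by (auto simp: total_uniform_def total_domination_number_def
          grundy_total_domination_number_def)
    have "?C \<noteq> {}" using total_dominating_set_pverts[OF assms I] by blast
    then have "?E" using Min_in[OF fin(1)] k by auto
    moreover have "?A" using Min_le[OF fin(1)] k by auto
    moreover have "?S" using Max_ge[OF fin(2)] k by auto
    ultimately show "?I \<and> ?E \<and> ?A \<and> ?S" using I by blast
  next
    assume R: "?I \<and> ?E \<and> ?A \<and> ?S"
    then obtain A where A: "total_dominating_set G A" "card A = k" by blast
    then have "Min ?C = k" using R by (intro Min_eqI fin) auto
    moreover obtain vs where "total_dominating_sequence G vs" "length vs = k"
      using total_dominating_sequence_of_minimum[of G A] assms A R by metis
    then have "Max ?M = k" using R by (intro Max_eqI fin) auto
    ultimately show ?L
      using R by (simp add: total_uniform_def total_domination_number_def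
          grundy_total_domination_number_def)
  qed
qed

section \<open>The product with \<open>K2\<close> and its two layers\<close>

locale graph_times_K2 = G: pair_graph G for G :: "'a pair_pre_digraph" +
  fixes K2 :: "'b pair_pre_digraph" and a b :: 'b
  assumes distinct_ab: "a \<noteq> b"
    and pverts_K2: "pverts K2 = {a, b}"
    and parcs_K2: "parcs K2 = {(a, b), (b, a)}"
begin

abbreviation "GK \<equiv> direct_product G K2"

text \<open>Transfers every fact about layer \<open>a\<close> to layer \<open>b\<close>.\<close>

lemma swap: "graph_times_K2 G K2 b a"
  by unfold_locales (use distinct_ab pverts_K2 parcs_K2 in auto)

lemma pair_graph_GK: "pair_graph GK"
proof (rule pair_graph_direct_product)
  show "pair_graph K2"
    by unfold_locales (use distinct_ab in \<open>auto simp: pverts_K2 parcs_K2 symmetric_def sym_def\<close>)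
qed unfold_locales

sublocale GK: pair_graph GK by (rule pair_graph_GK)

lemma pverts_GK: "pverts GK = pverts G \<times> {a, b}"
  by (simp add: pverts_direct_product pverts_K2)

lemma neighbors_GK: "neighbors GK (g, a) = neighbors G g \<times> {b}"
  "neighbors GK (g, b) = neighbors G g \<times> {a}"
  unfolding neighbors_direct_product using distinct_ab by (auto simp: neighbors_def parcs_K2)

lemma arc_GK: "((g, c), (g', c')) \<in> parcs GK \<longleftrightarrow>
    (g, g') \<in> parcs G \<and> (c = a \<and> c' = b \<or> c = b \<and> c' = a)"
  by (auto simp: direct_product_def parcs_K2)

section \<open>Connectedness of the product\<close>

lemma reachable_step:
  assumes "p \<rightarrow>\<^sup>*\<^bsub>with_proj GK\<^esub> q" "(q, r) \<in> parcs GK"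
  shows "p \<rightarrow>\<^sup>*\<^bsub>with_proj GK\<^esub> r"
  using assms GK.reachable_adj_trans by auto

text \<open>Exchanging the two layers is an automorphism of \<open>GK\<close>, so it maps walks to
  walks.\<close>

lemma reachable_other_layer:
  assumes "p \<rightarrow>\<^sup>*\<^bsub>with_proj GK\<^esub> q"
  defines "s \<equiv> \<lambda>(g, c). (g, if c = a then b else a)"
  shows "s p \<rightarrow>\<^sup>*\<^bsub>with_proj GK\<^esub> s q"
  using assms(1)
proof (induction rule: GK.reachable_induct)
  case base
  then show ?case by (auto simp: s_def pverts_GK intro!: GK.reachable_refl)
next
  case (step q r)
  have "(s q, s r) \<in> parcs GK"
    using step(2) distinct_ab by (cases q; cases r) (auto simp: s_def arc_GK)
  with step show ?case by (blast intro: reachable_step)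
qed

lemma connected_GK:
  assumes "Digraph_Component.connected (with_proj G)" and nbip: "\<not> bipartite G"
  shows "Digraph_Component.connected (with_proj GK)"
proof -
  have conn: "pverts G \<noteq> {}" "\<And>u v. u \<in> pverts G \<Longrightarrow> v \<in> pverts G \<Longrightarrow> u \<rightarrow>\<^sup>*\<^bsub>with_proj G\<^esub> v"
    using assms(1) pair_graph_connected_iff[OF G.pair_graph] by auto
  then obtain r where r: "r \<in> pverts G" by blast
  \<comment> \<open>Each arc of \<open>GK\<close> changes the layer, so \<open>U\<close> and
    \<open>V\<close> hold the ends of the walks of even and odd length from \<open>r\<close> in
    \<open>G\<close>.\<close>
  define U where "U = {g. (r, a) \<rightarrow>\<^sup>*\<^bsub>with_proj GK\<^esub> (g, a)}"
  define V where "V = {g. (r, a) \<rightarrow>\<^sup>*\<^bsub>with_proj GK\<^esub> (g, b)}"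
  have UV: "g' \<in> V" if "g \<in> U" "(g, g') \<in> parcs G" for g g'
    using that unfolding U_def V_def by (auto simp: arc_GK intro: reachable_step)
  have VU: "g' \<in> U" if "g \<in> V" "(g, g') \<in> parcs G" for g g'
    using that unfolding U_def V_def by (auto simp: arc_GK intro: reachable_step)
  have cover: "g \<in> U \<union> V" if "g \<in> pverts G" for g
    using conn(2)[OF r that]
  proof (induction rule: G.reachable_induct)
    case base
    then show ?case by (auto simp: U_def pverts_GK intro!: GK.reachable_refl)
  next
    case (step x y)
    then show ?case using UV VU by auto
  qed
  have verts: "pverts G = U \<union> V"
    using cover by (auto simp: U_def V_def pverts_GK dest: GK.reachable_in_verts(2))
  have arcs: "parcs G \<subseteq> U \<times> V \<union> V \<times> U"
  proof
    fix e assume "e \<in> parcs G"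
    moreover obtain x y where e: "e = (x, y)" by fastforce
    ultimately have xy: "(x, y) \<in> parcs G" by simp
    then show "e \<in> U \<times> V \<union> V \<times> U"
      using cover[OF G.in_arcsD1[OF xy]] UV[OF _ xy] VU[OF _ xy] e by blast
  qed
  \<comment> \<open>Were \<open>U\<close> and \<open>V\<close> disjoint, they would form a
    bipartition of \<open>G\<close>.\<close>
  obtain g where g: "g \<in> U" "g \<in> V"
    using nbip verts arcs unfolding bipartite_def by blast
  have "(r, b) \<rightarrow>\<^sup>*\<^bsub>with_proj GK\<^esub> (g, a)"
    using reachable_other_layer[of "(r, a)" "(g, b)"] g distinct_ab by (simp add: V_def)
  \<comment> \<open>Go from \<open>(r, a)\<close> to \<open>(g, a)\<close>, then back along the
    exchanged walk to \<open>(r, b)\<close>.\<close>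
  then have rarb: "(r, a) \<rightarrow>\<^sup>*\<^bsub>with_proj GK\<^esub> (r, b)"
    using g by (auto simp: U_def intro: GK.reachable_trans GK.symmetric_reachable')
  have all: "(r, a) \<rightarrow>\<^sup>*\<^bsub>with_proj GK\<^esub> (h, c)" if h: "h \<in> pverts G" and c: "c \<in> {a, b}" for h c
  proof -
    \<comment> \<open>One copy of \<open>h\<close> is reached already; exchanging the layers of that
      walk and starting it with \<open>rarb\<close> reaches the other copy.\<close>
    consider "h \<in> U" | "h \<in> V" using cover[OF h] by blast
    then have "h \<in> U \<and> h \<in> V"
    proof cases
      case 1
      then have "(r, b) \<rightarrow>\<^sup>*\<^bsub>with_proj GK\<^esub> (h, b)"
        using reachable_other_layer[of "(r, a)" "(h, a)"] by (simp add: U_def)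
      with 1 rarb show ?thesis by (auto simp: V_def intro: GK.reachable_trans)
    next
      case 2
      then have "(r, b) \<rightarrow>\<^sup>*\<^bsub>with_proj GK\<^esub> (h, a)"
        using reachable_other_layer[of "(r, a)" "(h, b)"] distinct_ab by (simp add: V_def)
      with 2 rarb show ?thesis by (auto simp: U_def intro: GK.reachable_trans)
    qed
    with c show ?thesis by (auto simp: U_def V_def)
  qed
  have "p \<rightarrow>\<^sup>*\<^bsub>with_proj GK\<^esub> q" if "p \<in> pverts GK" "q \<in> pverts GK" for p q
    using that all by (cases p; cases q)
      (auto simp: pverts_GK intro: GK.reachable_trans[OF GK.symmetric_reachable'])
  then show ?thesis
    using r by (auto simp: pair_graph_connected_iff[OF pair_graph_GK] pverts_GK)
qed

section \<open>Total domination in the product\<close>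

lemma no_isolated_vertices_GK:
  assumes "no_isolated_vertices G"
  shows "no_isolated_vertices GK"
  using assms by (auto simp: no_isolated_vertices_def pverts_GK neighbors_GK)

text \<open>All neighbors of \<open>(v, b)\<close> lie in layer \<open>a\<close>, so that layer of
  \<open>A\<close> alone must dominate it.\<close>

lemma total_dominating_set_layer:
  assumes "total_dominating_set GK A"
  shows "total_dominating_set G {g. (g, a) \<in> A}"
  unfolding total_dominating_set_def
proof (intro conjI ballI)
  show "{g. (g, a) \<in> A} \<subseteq> pverts G"
    using assms by (auto simp: total_dominating_set_def pverts_GK)
  fix v assume "v \<in> pverts G"
  then have "neighbors GK (v, b) \<inter> A \<noteq> {}"
    using assms by (auto simp: total_dominating_set_def pverts_GK)
  then show "neighbors G v \<inter> {g. (g, a) \<in> A} \<noteq> {}"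
    by (auto simp: neighbors_GK)
qed

lemma total_dominating_set_times:
  assumes "total_dominating_set G A"
  shows "total_dominating_set GK (A \<times> {a, b})"
  using assms by (fastforce simp: total_dominating_set_def pverts_GK neighbors_GK)

lemma card_layers:
  assumes "finite A" "A \<subseteq> pverts GK"
  shows "card A = card {g. (g, a) \<in> A} + card {g. (g, b) \<in> A}"
proof -
  let ?la = "(\<lambda>g. (g, a)) ` {g. (g, a) \<in> A}"
  let ?lb = "(\<lambda>g. (g, b)) ` {g. (g, b) \<in> A}"
  have A: "A = ?la \<union> ?lb" using assms(2) by (auto simp: pverts_GK)
  have "card A = card ?la + card ?lb"
    by (subst A, rule card_Un_disjoint)
      (use assms(1) distinct_ab in \<open>auto intro: finite_subset\<close>)
  then show ?thesis by (simp add: card_image inj_on_def)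
qed

text \<open>A neighbor that \<open>(y, a)\<close> adds to those of all earlier entries is in
  particular new against the earlier entries of layer \<open>a\<close>, and their neighborhoods are
  copies of those in \<open>G\<close>.\<close>

lemma total_dominating_sequence_layer:
  assumes iso: "no_isolated_vertices G" and vs: "total_dominating_sequence GK vs"
  defines "us \<equiv> map fst (filter (\<lambda>p. snd p = a) vs)"
  shows "total_dominating_sequence G us"
proof -
  have set_us: "set us = {g. (g, a) \<in> set vs}"
    by (force simp: us_def)
  have L: "set vs \<subseteq> pverts GK" "distinct vs"
      "\<And>xs y ys. vs = xs @ y # ys \<Longrightarrow> \<not> neighbors GK y \<subseteq> (\<Union>x \<in> set xs. neighbors GK x)"
    using vs by (auto simp: total_dominating_sequence_def
        legal_sequence_append_iff[OF no_isolated_vertices_GK[OF iso]])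
  have tds: "total_dominating_set G (set us)"
    using total_dominating_set_layer vs
    by (simp add: set_us total_dominating_sequence_def)
  have "distinct us"
    using L(2) by (auto simp: us_def distinct_map inj_on_def)
  moreover have "\<not> neighbors G y \<subseteq> (\<Union>x \<in> set xs. neighbors G x)" if eq: "us = xs @ y # ys"
    for xs y ys
  proof -
    \<comment> \<open>Lifts the split of \<open>us\<close> to the filtered list of pairs.\<close>
    obtain ps qs where ps: "filter (\<lambda>p. snd p = a) vs = ps @ (y, a) # qs" "xs = map fst ps"
    proof -
      from eq obtain ps q qs where *: "filter (\<lambda>p. snd p = a) vs = ps @ q # qs"
        "xs = map fst ps" "y = fst q"
        by (auto simp: us_def map_eq_append_conv map_eq_Cons_conv)
      have "q \<in> set (filter (\<lambda>p. snd p = a) vs)"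
        unfolding *(1) by simp
      then have "snd q = a" unfolding set_filter by blast
      then have "q = (y, a)" using *(3) by (cases q) simp
      then show thesis using *(1,2) that by simp
    qed
    have "(y, a) \<in> set (filter (\<lambda>p. snd p = a) vs)" unfolding ps(1) by simp
    then have "(y, a) \<in> set vs" by simp
    then obtain us1 us2 where us: "vs = us1 @ (y, a) # us2" by (meson split_list)
    then have "filter (\<lambda>p. snd p = a) us1 @ (y, a) # filter (\<lambda>p. snd p = a) us2
        = ps @ (y, a) # qs"
      using ps(1) by simp
    \<comment> \<open>By distinctness \<open>(y, a)\<close> occurs only once, so both splits around
      it have the same prefix.\<close>
    then have ps_us1: "ps = filter (\<lambda>p. snd p = a) us1"
      using L(2) us by (subst (asm) append_Cons_eq_iff) auto
    have "\<not> neighbors GK (y, a) \<subseteq> (\<Union>x \<in> set us1. neighbors GK x)"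
      using L(3) us by blast
    then obtain w where w: "w \<in> neighbors G y"
      "\<forall>x \<in> set us1. (w, b) \<notin> neighbors GK x"
      by (auto simp: neighbors_GK)
    have "w \<notin> neighbors G x" if "x \<in> set xs" for x
    proof -
      have "(x, a) \<in> set us1" using that ps(2) ps_us1 by auto
      then show ?thesis using w(2) by (force simp: neighbors_GK)
    qed
    with w(1) show ?thesis by blast
  qed
  ultimately show ?thesis
    using tds by (auto simp: total_dominating_sequence_def legal_sequence_append_iff[OF iso]
        total_dominating_set_def)
qed

lemma total_uniform_GK:
  assumes "total_uniform k G"
  shows "total_uniform (2 * k) GK"
proof -
  \<comment> \<open>Supplies the bounds for layer \<open>b\<close>; each total below is the sum of
    two layers.\<close>
  interpret sw: graph_times_K2 G K2 b a by (rule swap)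
  have G: "no_isolated_vertices G" "\<exists>A. total_dominating_set G A \<and> card A = k"
      "\<And>A. total_dominating_set G A \<Longrightarrow> k \<le> card A"
      "\<And>vs. total_dominating_sequence G vs \<Longrightarrow> length vs \<le> k"
    using assms by (auto simp: total_uniform_iff[OF G.pair_graph])
  obtain A where A: "total_dominating_set G A" "card A = k" using G(2) by blast
  have "card (A \<times> {a, b}) = 2 * k"
    using A(2) distinct_ab by (simp add: card_cartesian_product)
  then have "\<exists>A. total_dominating_set GK A \<and> card A = 2 * k"
    using total_dominating_set_times[OF A(1)] by blast
  moreover have "2 * k \<le> card B" if B: "total_dominating_set GK B" for B
  proof -
    have "B \<subseteq> pverts GK" using B by (simp add: total_dominating_set_def)
    then show ?thesis
      using card_layers[of B] finite_subset[OF _ GK.pair_finite_verts]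
        G(3)[OF total_dominating_set_layer[OF B]] G(3)[OF sw.total_dominating_set_layer[OF B]]
      by simp
  qed
  moreover have "length vs \<le> 2 * k" if vs: "total_dominating_sequence GK vs" for vs
  proof -
    have "set vs \<subseteq> pverts G \<times> {a, b}"
      using vs by (simp add: total_dominating_sequence_def legal_sequence_def pverts_GK)
    \<comment> \<open>Every entry lies in one of the two layers, so the complement of the
      \<open>a\<close> filter is the \<open>b\<close> filter.\<close>
    then have "filter (\<lambda>p. snd p \<noteq> a) vs = filter (\<lambda>p. snd p = b) vs"
      using distinct_ab by (intro filter_cong) auto
    then have "length vs = length (filter (\<lambda>p. snd p = a) vs) + length (filter (\<lambda>p. snd p = b) vs)"
      using sum_length_filter_compl[of "\<lambda>p. snd p = a" vs] by simp
    then show ?thesis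
      using G(4)[OF total_dominating_sequence_layer[OF G(1) vs]]
        G(4)[OF sw.total_dominating_sequence_layer[OF G(1) vs]] by simp
  qed
  ultimately show ?thesis
    using no_isolated_vertices_GK[OF G(1)] by (auto simp: total_uniform_iff[OF pair_graph_GK])
qed

end

theorem theorem3p4:
  fixes G :: "'a pair_pre_digraph" and K2 :: "'b pair_pre_digraph" and k :: nat
  assumes "pair_graph G"
    and "Digraph_Component.connected (with_proj G)"
    and "\<not> bipartite G"
    and "total_uniform k G"
    and "complete_digraph 2 (with_proj K2)"
  shows "pair_graph (direct_product G K2)
    \<and> Digraph_Component.connected (with_proj (direct_product G K2))
    \<and> total_uniform (2 * k) (direct_product G K2)"
proof -
  have K2: "card (pverts K2) = 2"
      "parcs K2 = {(u, v). (u, v) \<in> pverts K2 \<times> pverts K2 \<and> u \<noteq> v}"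
    using assms(5) unfolding complete_digraph_pair_def by blast+
  obtain a b where ab: "pverts K2 = {a, b}" "a \<noteq> b"
    using K2(1) by (auto simp: card_2_iff)
  interpret graph_times_K2 G K2 a b
    by (intro graph_times_K2.intro graph_times_K2_axioms.intro assms(1)) (use ab K2(2) in auto)
  show ?thesis
    using pair_graph_GK connected_GK[OF assms(2,3)] total_uniform_GK[OF assms(4)] by blast
qed

end
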